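(* Let $Y$ be a random variable whose moment generating function $E[e^{tY}]$ exists for $|t|<r$, for some $r>0$. Let $(Y_j)_{j\ge1}$ be mutually independent copies of $Y$, with $S_0=0$ and $S_k=Y_1+\cdots+Y_k$ for $k\ge1$. Let $B_{n}^{(c,Y)}(x)$ be defined by $$e^{x(E[e^{\frac{Y}{2}t}]-E[e^{-\frac{Y}{2}t}])}= \sum_{n=0}^{\infty}B_{n}^{(c,Y)}(x)\frac{t^{n}}{n!}.$$ Then for every $n\ge0$, $$B_{n}^{(c,Y)}(x)=\frac{1}{2^{n}}\sum_{l=0}^{\infty}\sum_{j=0}^{\infty}\frac{x^{l+j}}{l!\,j!}(-1)^{j}\sum_{m=0}^{n}\binom{n}{m}(-1)^{n-m}E\big[S_{l}^{m}\big]E\big[S_{j}^{n-m}\big].$$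
   Context: Equivalently $B_n^{(c,Y)}(x)=\sum_{k=0}^n T^Y(n,k)x^k$, where $\frac{1}{k!}(E[e^{\frac{Y}{2}t}]-E[e^{-\frac{Y}{2}t}])^k=\sum_{n\ge k}T^Y(n,k)\frac{t^n}{n!}$ (probabilistic central Bell polynomials). *)

theory Defs
  imports "HOL-Probability.Probability"
begin

definition central_bell_gf :: "'a measure \<Rightarrow> ('a \<Rightarrow> real) \<Rightarrow> real \<Rightarrow> real \<Rightarrow> real" where
  "central_bell_gf M Y x t =
     exp (x * ((\<integral>\<omega>. exp (Y \<omega> / 2 * t) \<partial>M) - (\<integral>\<omega>. exp (- (Y \<omega> / 2) * t) \<partial>M)))"

(* The generating function only exists for small t (|t| < 2 r when the moment generating function
   of Y exists on |t| < r), so its expansion is required on a neighbourhood of 0. Coefficients of a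
   convergent power series are determined by its values near 0, hence the description is unique. *)
definition prob_central_bell :: "'a measure \<Rightarrow> ('a \<Rightarrow> real) \<Rightarrow> nat \<Rightarrow> real \<Rightarrow> real" where
  "prob_central_bell M Y n x =
     (THE b :: nat \<Rightarrow> real.
        \<forall>\<^sub>F t in nhds 0. (\<lambda>k. b k * (t ^ k / fact k)) sums central_bell_gf M Y x t) n"

definition partial_sum :: "(nat \<Rightarrow> 'b \<Rightarrow> real) \<Rightarrow> nat \<Rightarrow> 'b \<Rightarrow> real" where
  "partial_sum X k \<omega> = (\<Sum>j = 1..k. X j \<omega>)"

(* The copies X 1, X 2, ... may live on another probability space N than Y; X 0 plays no role. *)
definition independent_copies ::
    "'a measure \<Rightarrow> ('a \<Rightarrow> real) \<Rightarrow> 'b measure \<Rightarrow> (nat \<Rightarrow> 'b \<Rightarrow> real) \<Rightarrow> bool" where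
  "independent_copies M Y N X \<longleftrightarrow>
     prob_space.indep_vars N (\<lambda>_. borel) X {1..} \<and>
     (\<forall>j\<ge>1. distr N borel (X j) = distr M borel Y)"

end

theory Submission
  imports Defs "HOL-Complex_Analysis.Cauchy_Integral_Formula"
begin

(* Write phi t = E[exp (t Y)]. By independence phi t ^ l = E[exp (t S_l)] = (\<Sum>k. E[S_l^k] t^k / k!), so expanding
   exp (y * phi t) = (\<Sum>l. y^l / l! * phi t ^ l) and exchanging the sums gives a power series in t with
   coefficients c y k = (\<Sum>l. y^l / l! * E[S_l^k]). The exchange is legitimate because the absolute values
   are dominated by exp (|y| E[exp (|t| |Y|)]). The generating function is the product of
   exp (x * phi (t/2)) and exp (-x * phi (-t/2)); taking the Cauchy product for fixed powers of t turns
   the double series over l and j into a finite combination of products c x m * c (-x) (n-m). *)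

section \<open>Uniqueness of power series expansions at 0\<close>

text \<open>Zeros of a nonzero power series are isolated: the difference series sums to 0 near 0,
  whereas a nonzero coefficient would make its sum nonzero throughout a small punctured
  ball.\<close>

lemma power_series_eqD:
  fixes a b :: "nat \<Rightarrow> real"
  assumes "\<forall>\<^sub>F t in nhds 0. (\<lambda>k. a k * t ^ k) sums f t"
    and "\<forall>\<^sub>F t in nhds 0. (\<lambda>k. b k * t ^ k) sums f t"
  shows "a = b"
proof (rule ccontr)
  define c where "c k = a k - b k" for k
  assume "a \<noteq> b"
  then obtain m where m: "c m \<noteq> 0"
    by (auto simp: c_def)
  have "\<forall>\<^sub>F t in nhds 0. (\<lambda>k. c k * t ^ k) sums 0"
    using assms
  proof eventually_elim
    case (elim t)
    from sums_diff[OF elim] show ?case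
      by (simp add: c_def left_diff_distrib)
  qed
  then obtain e where e: "e > 0" "\<And>t. \<bar>t\<bar> < e \<Longrightarrow> (\<lambda>k. c k * t ^ k) sums 0"
    unfolding eventually_nhds_metric by (auto simp: dist_real_def)
  \<comment> \<open>\<open>powser_0_nonzero\<close> asks for a nonzero coefficient of positive
    index, so the constant coefficient is settled first by evaluating at 0.\<close>
  have "c 0 = 0"
    using sums_unique2[OF e(2)[of 0] powser_sums_zero[of c]] e(1) by simp
  with m have "m > 0"
    by (cases m) auto
  obtain s where "0 < s" and s: "\<And>z::real. z \<in> cball 0 s - {0} \<Longrightarrow> (0::real) \<noteq> 0"
    by (rule powser_0_nonzero[of e 0 c "\<lambda>_. 0" m]) (use e m \<open>m > 0\<close> in auto)
  show False
    using s[of s] \<open>0 < s\<close> by auto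
qed

text \<open>Resolves the definite description: the given expansion provides existence, and
  uniqueness is that of power series coefficients once \<open>1 / fact k\<close> is absorbed into
  them.\<close>

lemma prob_central_bell_eqI:
  assumes "\<forall>\<^sub>F t in nhds 0. (\<lambda>k. b k * (t ^ k / fact k)) sums central_bell_gf M Y x t"
  shows "prob_central_bell M Y n x = b n"
proof -
  have "(THE b. \<forall>\<^sub>F t in nhds 0. (\<lambda>k. b k * (t ^ k / fact k)) sums central_bell_gf M Y x t) = b"
  proof (rule the_equality)
    fix b' assume b': "\<forall>\<^sub>F t in nhds 0. (\<lambda>k. b' k * (t ^ k / fact k)) sums central_bell_gf M Y x t"
    have "(\<lambda>k. b' k / fact k) = (\<lambda>k. b k / fact k)"
      by (rule power_series_eqD[where f = "central_bell_gf M Y x"]) (use assms b' in simp_all)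
    then show "b' = b"
      by (simp add: fun_eq_iff)
  qed (fact assms)
  then show ?thesis
    by (simp add: prob_central_bell_def)
qed

section \<open>Moments and exponential moments of a single variable\<close>

lemma exp_partial_sum_le:
  fixes y :: real
  assumes "y \<ge> 0"
  shows "(\<Sum>k<n. y ^ k / fact k) \<le> exp y"
proof -
  have "(\<lambda>k. y ^ k / fact k) sums exp y"
    using exp_converges[of y] by (simp add: divide_inverse mult.commute)
  then show ?thesis
    using sum_le_suminf[of "\<lambda>k. y ^ k / fact k" "{..<n}"] assms by (simp add: sums_iff)
qed

text \<open>The exponential series may be integrated term by term, because the partial sums of its
  absolute values are all dominated by the integrable
  \<open>exp (\<bar>t\<bar> * \<bar>Z \<omega>\<bar>)\<close>.\<close>

lemma moment_series_sums_mgf: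
  fixes Z :: "'a \<Rightarrow> real"
  assumes [measurable]: "Z \<in> borel_measurable M"
    and int: "integrable M (\<lambda>\<omega>. exp (\<bar>t\<bar> * \<bar>Z \<omega>\<bar>))"
  shows "(\<lambda>k. (\<integral>\<omega>. Z \<omega> ^ k \<partial>M) * (t ^ k / fact k)) sums (\<integral>\<omega>. exp (t * Z \<omega>) \<partial>M)"
proof -
  define f where "f k \<omega> = Z \<omega> ^ k * (t ^ k / fact k)" for k \<omega>
  have norm_f: "norm (f k \<omega>) = (\<bar>t\<bar> * \<bar>Z \<omega>\<bar>) ^ k / fact k" for k \<omega>
    by (simp add: f_def abs_mult power_abs power_mult_distrib)
  have [measurable]: "f k \<in> borel_measurable M" for k
    by (simp add: f_def[abs_def])
  have f_series: "(\<lambda>k. f k \<omega>) sums exp (t * Z \<omega>)" for \<omega>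
    using exp_converges[of "t * Z \<omega>"]
    by (simp add: f_def power_mult_distrib divide_inverse scaleR_conv_of_real mult_ac)
  have int_f: "integrable M (f k)" for k
  proof (rule Bochner_Integration.integrable_bound[OF int])
    have "norm (f k \<omega>) \<le> exp (\<bar>t\<bar> * \<bar>Z \<omega>\<bar>)" for \<omega>
    proof -
      \<comment> \<open>A single term is at most the partial sum that ends with it, all terms being
        nonnegative.\<close>
      have "norm (f k \<omega>) \<le> (\<Sum>i<Suc k. (\<bar>t\<bar> * \<bar>Z \<omega>\<bar>) ^ i / fact i)"
        by (simp add: norm_f sum_nonneg del: real_norm_def)
      also have "\<dots> \<le> exp (\<bar>t\<bar> * \<bar>Z \<omega>\<bar>)"
        by (rule exp_partial_sum_le) simp
      finally show ?thesis .
    qed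
    then show "AE \<omega> in M. norm (f k \<omega>) \<le> norm (exp (\<bar>t\<bar> * \<bar>Z \<omega>\<bar>))"
      by simp
  qed simp
  have "(\<lambda>k. integral\<^sup>L M (f k)) sums (\<integral>\<omega>. (\<Sum>k. f k \<omega>) \<partial>M)"
  proof (rule sums_integral[OF int_f])
    show "AE \<omega> in M. summable (\<lambda>k. norm (f k \<omega>))"
      unfolding norm_f divide_inverse using summable_exp[where 'a = real] by (simp only: mult.commute) simp
    show "summable (\<lambda>k. \<integral>\<omega>. norm (f k \<omega>) \<partial>M)"
    proof (rule summableI_nonneg_bounded)
      fix n
      have "(\<Sum>k<n. \<integral>\<omega>. norm (f k \<omega>) \<partial>M) = (\<integral>\<omega>. (\<Sum>k<n. norm (f k \<omega>)) \<partial>M)"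
        using int_f by (subst Bochner_Integration.integral_sum) auto
      also have "\<dots> \<le> (\<integral>\<omega>. exp (\<bar>t\<bar> * \<bar>Z \<omega>\<bar>) \<partial>M)"
      proof (rule integral_mono)
        show "(\<Sum>k<n. norm (f k \<omega>)) \<le> exp (\<bar>t\<bar> * \<bar>Z \<omega>\<bar>)" for \<omega>
          unfolding norm_f by (rule exp_partial_sum_le) simp
      qed (use int int_f in simp_all)
      finally show "(\<Sum>k<n. \<integral>\<omega>. norm (f k \<omega>) \<partial>M) \<le> (\<integral>\<omega>. exp (\<bar>t\<bar> * \<bar>Z \<omega>\<bar>) \<partial>M)" .
    qed simp
  qed
  moreover have "integral\<^sup>L M (f k) = (\<integral>\<omega>. Z \<omega> ^ k \<partial>M) * (t ^ k / fact k)" for k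
    unfolding f_def[abs_def] by (rule integral_mult_left_zero)
  moreover have "(\<Sum>k. f k \<omega>) = exp (t * Z \<omega>)" for \<omega>
    using f_series by (rule sums_unique[symmetric])
  ultimately show ?thesis
    by simp
qed

text \<open>Absolute values of moments are at most absolute moments, and the series of the latter is
  the moment series of \<open>\<bar>Z \<omega>\<bar>\<close> at
  \<open>\<bar>t\<bar>\<close>.\<close>

lemma moment_series_abs_bound:
  fixes Z :: "'a \<Rightarrow> real"
  assumes "Z \<in> borel_measurable M" and "integrable M (\<lambda>\<omega>. exp (\<bar>t\<bar> * \<bar>Z \<omega>\<bar>))"
  shows "summable (\<lambda>k. \<bar>\<integral>\<omega>. Z \<omega> ^ k \<partial>M\<bar> * (\<bar>t\<bar> ^ k / fact k))"
    and "(\<Sum>k. \<bar>\<integral>\<omega>. Z \<omega> ^ k \<partial>M\<bar> * (\<bar>t\<bar> ^ k / fact k)) \<le> (\<integral>\<omega>. exp (\<bar>t\<bar> * \<bar>Z \<omega>\<bar>) \<partial>M)"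
proof -
  have abs_sums: "(\<lambda>k. (\<integral>\<omega>. \<bar>Z \<omega>\<bar> ^ k \<partial>M) * (\<bar>t\<bar> ^ k / fact k)) sums (\<integral>\<omega>. exp (\<bar>t\<bar> * \<bar>Z \<omega>\<bar>) \<partial>M)"
    by (rule moment_series_sums_mgf) (use assms in simp_all)
  have le: "\<bar>\<integral>\<omega>. Z \<omega> ^ k \<partial>M\<bar> * (\<bar>t\<bar> ^ k / fact k) \<le> (\<integral>\<omega>. \<bar>Z \<omega>\<bar> ^ k \<partial>M) * (\<bar>t\<bar> ^ k / fact k)" for k
    using integral_abs_bound[of M "\<lambda>\<omega>. Z \<omega> ^ k"] by (intro mult_right_mono) (simp_all add: power_abs)
  show summ: "summable (\<lambda>k. \<bar>\<integral>\<omega>. Z \<omega> ^ k \<partial>M\<bar> * (\<bar>t\<bar> ^ k / fact k))"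
    by (rule summable_comparison_test'[OF sums_summable[OF abs_sums]]) (use le in simp)
  show "(\<Sum>k. \<bar>\<integral>\<omega>. Z \<omega> ^ k \<partial>M\<bar> * (\<bar>t\<bar> ^ k / fact k)) \<le> (\<integral>\<omega>. exp (\<bar>t\<bar> * \<bar>Z \<omega>\<bar>) \<partial>M)"
    unfolding sums_unique[OF abs_sums] by (rule suminf_le[OF le summ sums_summable[OF abs_sums]])
qed

section \<open>Exponential moments of sums of independent copies\<close>

lemma independent_copies_measurable:
  assumes "prob_space N" and "independent_copies M Y N X" and "j \<ge> 1"
  shows "X j \<in> borel_measurable N"
  using assms by (auto simp: independent_copies_def prob_space.indep_vars_def)

lemma partial_sum_measurable:
  assumes "prob_space N" and "independent_copies M Y N X"
  shows "partial_sum X l \<in> borel_measurable N"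
  unfolding partial_sum_def[abs_def]
  using independent_copies_measurable[OF assms] by (intro borel_measurable_sum) auto

text \<open>Independence survives composition with \<open>g\<close> and makes the expectation
  multiplicative; each factor passes from \<open>N\<close> to \<open>M\<close> through the common
  distribution of \<open>X j\<close> and \<open>Y\<close>. A general \<open>g\<close> serves both
  the exponential of \<open>t * y\<close> and that of its absolute value.\<close>

lemma independent_copies_prod:
  fixes g :: "real \<Rightarrow> real"
  assumes N: "prob_space N" and X: "independent_copies M Y N X"
    and Y: "Y \<in> borel_measurable M"
    and [measurable]: "g \<in> borel_measurable borel" and int: "integrable M (\<lambda>\<omega>. g (Y \<omega>))"
  shows "integrable N (\<lambda>\<omega>. \<Prod>j=1..l. g (X j \<omega>))"
    and "(\<integral>\<omega>. (\<Prod>j=1..l. g (X j \<omega>)) \<partial>N) = (\<integral>\<omega>. g (Y \<omega>) \<partial>M) ^ l"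
proof -
  interpret prob_space N by fact
  note [measurable] = independent_copies_measurable[OF N X] Y
  have distr: "distr N borel (X j) = distr M borel Y" if "j \<ge> 1" for j
    using X that by (simp add: independent_copies_def)
  have "indep_vars (\<lambda>_. borel) X {1..l}"
    by (rule indep_vars_subset[of _ _ "{1..}"]) (use X in \<open>auto simp: independent_copies_def\<close>)
  then have ind: "indep_vars (\<lambda>_. borel) (\<lambda>j \<omega>. g (X j \<omega>)) {1..l}"
    by (rule indep_vars_compose2) simp
  have int_X: "integrable N (\<lambda>\<omega>. g (X j \<omega>))" if j: "j \<in> {1..l}" for j
  proof -
    have "integrable (distr N borel (X j)) g"
      using int j Y by (simp add: distr integrable_distr_eq)
    then show ?thesis
      using independent_copies_measurable[OF N X] j by (simp add: integrable_distr_eq)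
  qed
  have eq: "(\<integral>\<omega>. g (X j \<omega>) \<partial>N) = (\<integral>\<omega>. g (Y \<omega>) \<partial>M)" if j: "j \<in> {1..l}" for j
  proof -
    have "(\<integral>\<omega>. g (X j \<omega>) \<partial>N) = integral\<^sup>L (distr N borel (X j)) g"
      using independent_copies_measurable[OF N X] j by (simp add: integral_distr)
    also have "\<dots> = (\<integral>\<omega>. g (Y \<omega>) \<partial>M)"
      using j Y by (simp add: distr integral_distr)
    finally show ?thesis .
  qed
  show "integrable N (\<lambda>\<omega>. \<Prod>j=1..l. g (X j \<omega>))"
    by (rule indep_vars_integrable[OF _ ind int_X]) auto
  show "(\<integral>\<omega>. (\<Prod>j=1..l. g (X j \<omega>)) \<partial>N) = (\<integral>\<omega>. g (Y \<omega>) \<partial>M) ^ l"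
    by (subst indep_vars_lebesgue_integral[OF _ ind int_X]) (simp_all add: eq)
qed

lemma integral_exp_partial_sum:
  assumes N: "prob_space N" and X: "independent_copies M Y N X"
    and Y: "Y \<in> borel_measurable M" and int: "integrable M (\<lambda>\<omega>. exp (t * Y \<omega>))"
  shows "(\<integral>\<omega>. exp (t * partial_sum X l \<omega>) \<partial>N) = (\<integral>\<omega>. exp (t * Y \<omega>) \<partial>M) ^ l"
proof -
  have "exp (t * partial_sum X l \<omega>) = (\<Prod>j=1..l. exp (t * X j \<omega>))" for \<omega>
    by (simp only: partial_sum_def sum_distrib_left exp_sum finite_atLeastAtMost)
  then show ?thesis
    using independent_copies_prod(2)[OF N X Y, of "\<lambda>y. exp (t * y)" l] int by simp
qed

text \<open>The triangle inequality bounds the exponential by a product of independent factors. The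
  bound is geometric in \<open>l\<close>, which the weights \<open>1 / fact l\<close> of the
  exponential series later outweigh.\<close>

lemma exp_abs_partial_sum:
  assumes N: "prob_space N" and X: "independent_copies M Y N X"
    and Y: "Y \<in> borel_measurable M" and int: "integrable M (\<lambda>\<omega>. exp (\<bar>t\<bar> * \<bar>Y \<omega>\<bar>))"
  shows "integrable N (\<lambda>\<omega>. exp (\<bar>t\<bar> * \<bar>partial_sum X l \<omega>\<bar>))"
    and "(\<integral>\<omega>. exp (\<bar>t\<bar> * \<bar>partial_sum X l \<omega>\<bar>) \<partial>N) \<le> (\<integral>\<omega>. exp (\<bar>t\<bar> * \<bar>Y \<omega>\<bar>) \<partial>M) ^ l"
proof -
  note [measurable] = partial_sum_measurable[OF N X]
  have le: "exp (\<bar>t\<bar> * \<bar>partial_sum X l \<omega>\<bar>) \<le> (\<Prod>j=1..l. exp (\<bar>t\<bar> * \<bar>X j \<omega>\<bar>))" for \<omega>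
    by (simp add: partial_sum_def sum_distrib_left[symmetric] exp_sum[symmetric] mult_left_mono sum_abs)
  have prod_int: "integrable N (\<lambda>\<omega>. \<Prod>j=1..l. exp (\<bar>t\<bar> * \<bar>X j \<omega>\<bar>))"
    by (rule independent_copies_prod(1)[OF N X Y _ int]) simp
  show int_S: "integrable N (\<lambda>\<omega>. exp (\<bar>t\<bar> * \<bar>partial_sum X l \<omega>\<bar>))"
    by (rule Bochner_Integration.integrable_bound[OF prod_int])
      (use le in \<open>auto simp: abs_prod intro!: AE_I2\<close>)
  have "(\<integral>\<omega>. exp (\<bar>t\<bar> * \<bar>partial_sum X l \<omega>\<bar>) \<partial>N) \<le> (\<integral>\<omega>. (\<Prod>j=1..l. exp (\<bar>t\<bar> * \<bar>X j \<omega>\<bar>)) \<partial>N)"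
    by (rule integral_mono[OF int_S prod_int le])
  also have "\<dots> = (\<integral>\<omega>. exp (\<bar>t\<bar> * \<bar>Y \<omega>\<bar>) \<partial>M) ^ l"
    by (rule independent_copies_prod(2)[OF N X Y _ int]) simp
  finally show "(\<integral>\<omega>. exp (\<bar>t\<bar> * \<bar>partial_sum X l \<omega>\<bar>) \<partial>N) \<le> (\<integral>\<omega>. exp (\<bar>t\<bar> * \<bar>Y \<omega>\<bar>) \<partial>M) ^ l" .
qed

section \<open>Rearrangement of the double series for the exponential of the generating
  function\<close>

text \<open>Here \<open>\<mu> l k\<close> stands for the \<open>k\<close>-th moment of the
  \<open>l\<close>-th partial sum, \<open>A\<close> for the moment generating function at
  \<open>t\<close>, and \<open>B\<close> for the expectation of
  \<open>exp (\<bar>t\<bar> * \<bar>Y \<omega>\<bar>)\<close>. The absolute row sums are at most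
  \<open>(\<bar>x\<bar> * B) ^ l / fact l\<close>, so the family is absolutely summable over
  pairs.\<close>

lemma exp_mixture_has_sum:
  fixes \<mu> :: "nat \<Rightarrow> nat \<Rightarrow> real" and A B t x :: real
  assumes A: "\<And>l. (\<lambda>k. \<mu> l k * (t ^ k / fact k)) sums A ^ l"
    and summ: "\<And>l. summable (\<lambda>k. \<bar>\<mu> l k\<bar> * (\<bar>t\<bar> ^ k / fact k))"
    and B: "\<And>l. (\<Sum>k. \<bar>\<mu> l k\<bar> * (\<bar>t\<bar> ^ k / fact k)) \<le> B ^ l"
  shows "((\<lambda>(l, k). x ^ l / fact l * (\<mu> l k * (t ^ k / fact k))) has_sum exp (x * A)) (UNIV \<times> UNIV)"
proof -
  define F where "F = (\<lambda>(l, k). x ^ l / fact l * (\<mu> l k * (t ^ k / fact k)))"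
  define G where "G l = \<bar>x\<bar> ^ l / fact l * (\<Sum>k. \<bar>\<mu> l k\<bar> * (\<bar>t\<bar> ^ k / fact k))" for l
  have norm_F: "norm (F (l, k)) = \<bar>x\<bar> ^ l / fact l * (\<bar>\<mu> l k\<bar> * (\<bar>t\<bar> ^ k / fact k))" for l k
    by (simp add: F_def abs_mult power_abs)
  have F_rows: "((\<lambda>k. norm (F (l, k))) has_sum G l) UNIV" for l
    unfolding norm_F G_def
    by (intro has_sum_cmult_right sums_nonneg_imp_has_sum summable_sums summ) simp
  have H: "summable (\<lambda>l. (\<bar>x\<bar> * B) ^ l / fact l)"
    using summable_exp[of "\<bar>x\<bar> * B"] by (simp add: divide_inverse mult.commute)
  have G_nonneg: "G l \<ge> 0" for l
    unfolding G_def by (intro mult_nonneg_nonneg suminf_nonneg summ) simp_all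
  have "norm (G l) \<le> (\<bar>x\<bar> * B) ^ l / fact l" for l
    using mult_left_mono[OF B[of l], of "\<bar>x\<bar> ^ l / fact l"] G_nonneg[of l]
    by (simp add: G_def power_mult_distrib)
  then have "summable G"
    by (rule summable_comparison_test'[OF H])
  then have "G summable_on UNIV"
    using G_nonneg by (simp add: summable_on_UNIV_nonneg_real_iff)
  then have "(\<lambda>p. norm (F p)) summable_on UNIV \<times> UNIV"
    by (rule summable_on_SigmaI[OF F_rows]) simp
  then have "F summable_on UNIV \<times> UNIV"
    by (rule abs_summable_summable)
  then obtain S where S: "(F has_sum S) (UNIV \<times> UNIV)"
    by (auto simp: summable_on_def)
  \<comment> \<open>The value of the double sum is identified by summing rows first, which leaves
    the exponential series of \<open>x * A\<close>.\<close>
  have "((\<lambda>l. x ^ l / fact l * A ^ l) has_sum S) UNIV"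
  proof (rule has_sum_SigmaD[OF S])
    fix l :: nat
    have "((\<lambda>k. \<mu> l k * (t ^ k / fact k)) has_sum A ^ l) UNIV"
      by (rule norm_summable_imp_has_sum[OF _ A]) (use summ[of l] in \<open>simp add: abs_mult power_abs\<close>)
    from has_sum_cmult_right[OF this, of "x ^ l / fact l"]
    show "((\<lambda>k. F (l, k)) has_sum x ^ l / fact l * A ^ l) UNIV"
      by (simp only: F_def prod.case)
  qed
  moreover have "(\<lambda>l. x ^ l / fact l * A ^ l) sums exp (x * A)"
    using exp_converges[of "x * A"] by (simp add: power_mult_distrib divide_inverse mult_ac)
  ultimately have "S = exp (x * A)"
    by (blast intro: sums_unique2 has_sum_imp_sums)
  with S show ?thesis
    by (simp add: F_def)
qed

text \<open>Each column of a summable double family is summable; the common factor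
  \<open>t ^ k / fact k\<close> cancels because \<open>t\<close> is nonzero.\<close>

lemma exp_mixture_coeff_summable:
  fixes \<mu> :: "nat \<Rightarrow> nat \<Rightarrow> real" and A B t x :: real
  assumes "\<And>l. (\<lambda>k. \<mu> l k * (t ^ k / fact k)) sums A ^ l"
    and "\<And>l. summable (\<lambda>k. \<bar>\<mu> l k\<bar> * (\<bar>t\<bar> ^ k / fact k))"
    and "\<And>l. (\<Sum>k. \<bar>\<mu> l k\<bar> * (\<bar>t\<bar> ^ k / fact k)) \<le> B ^ l"
    and "t \<noteq> 0"
  shows "(\<lambda>l. x ^ l / fact l * \<mu> l k) summable_on UNIV"
proof -
  have "(\<lambda>(l, k). x ^ l / fact l * (\<mu> l k * (t ^ k / fact k))) summable_on UNIV \<times> UNIV"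
    by (rule has_sum_imp_summable[OF exp_mixture_has_sum[OF assms(1-3)]])
  then have "(\<lambda>(k, l). x ^ l / fact l * (\<mu> l k * (t ^ k / fact k))) summable_on UNIV \<times> UNIV"
    by (subst (asm) summable_on_swap) simp
  from summable_on_SigmaD1[OF this, of k]
  have "(\<lambda>l. (x ^ l / fact l * \<mu> l k) * (t ^ k / fact k)) summable_on UNIV"
    by (simp add: mult.assoc)
  then show ?thesis
    by (subst (asm) summable_on_cmult_left') (use \<open>t \<noteq> 0\<close> in simp_all)
qed

text \<open>Summing the same double family by columns instead of rows exhibits it as a power series
  in \<open>t\<close>.\<close>

lemma exp_mixture_series:
  fixes \<mu> :: "nat \<Rightarrow> nat \<Rightarrow> real" and A B t x :: real
  assumes "\<And>l. (\<lambda>k. \<mu> l k * (t ^ k / fact k)) sums A ^ l"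
    and "\<And>l. summable (\<lambda>k. \<bar>\<mu> l k\<bar> * (\<bar>t\<bar> ^ k / fact k))"
    and "\<And>l. (\<Sum>k. \<bar>\<mu> l k\<bar> * (\<bar>t\<bar> ^ k / fact k)) \<le> B ^ l"
    and "\<And>k. ((\<lambda>l. x ^ l / fact l * \<mu> l k) has_sum c k) UNIV"
  shows "((\<lambda>k. c k * (t ^ k / fact k)) has_sum exp (x * A)) UNIV"
proof (rule has_sum_SigmaD)
  show "((\<lambda>(k, l). x ^ l / fact l * (\<mu> l k * (t ^ k / fact k))) has_sum exp (x * A)) (UNIV \<times> UNIV)"
    using exp_mixture_has_sum[OF assms(1-3), of x] by (subst (asm) has_sum_swap) simp
  show "((\<lambda>l. case (k, l) of (k, l) \<Rightarrow> x ^ l / fact l * (\<mu> l k * (t ^ k / fact k)))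
          has_sum c k * (t ^ k / fact k)) UNIV" for k
    using has_sum_cmult_left[OF assms(4)[of k], of "t ^ k / fact k"] by (simp add: mult.assoc)
qed

section \<open>Cauchy product of the two expansions and return to the iterated series\<close>

text \<open>Convergence of the inner and outer series is asserted alongside the identity, since an
  equation between \<open>suminf\<close> terms does not by itself express it.\<close>

theorem theorem2p3:
  fixes M :: "'a measure" and Y :: "'a \<Rightarrow> real"
    and N :: "'b measure" and X :: "nat \<Rightarrow> 'b \<Rightarrow> real"
    and r x :: real and n :: nat
  assumes "prob_space M" and "Y \<in> borel_measurable M"
    and "r > 0" and "\<And>t. \<bar>t\<bar> < r \<Longrightarrow> integrable M (\<lambda>\<omega>. exp (t * Y \<omega>))"
    and "prob_space N" and "independent_copies M Y N X"
  shows "let a = (\<lambda>l j. x ^ (l + j) / (fact l * fact j) * (-1) ^ j *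
                 (\<Sum>m = 0..n. real (n choose m) * (-1) ^ (n - m) *
                    (\<integral>\<omega>. partial_sum X l \<omega> ^ m \<partial>N) *
                    (\<integral>\<omega>. partial_sum X j \<omega> ^ (n - m) \<partial>N)))
         in (\<forall>l. summable (\<lambda>j. a l j)) \<and> summable (\<lambda>l. \<Sum>j. a l j) \<and>
            prob_central_bell M Y n x = 1 / 2 ^ n * (\<Sum>l. \<Sum>j. a l j)"
proof -
  note [measurable] = assms(2) partial_sum_measurable[OF assms(5,6)]
  define \<mu> where "\<mu> l k = (\<integral>\<omega>. partial_sum X l \<omega> ^ k \<partial>N)" for l k
  define \<phi> where "\<phi> t = (\<integral>\<omega>. exp (t * Y \<omega>) \<partial>M)" for t
  define \<psi> where "\<psi> t = (\<integral>\<omega>. exp (\<bar>t\<bar> * \<bar>Y \<omega>\<bar>) \<partial>M)" for t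
  have int_abs: "integrable M (\<lambda>\<omega>. exp (\<bar>t\<bar> * \<bar>Y \<omega>\<bar>))" if "\<bar>t\<bar> < r" for t
  proof (rule Bochner_Integration.integrable_bound)
    show "integrable M (\<lambda>\<omega>. exp (t * Y \<omega>) + exp (- t * Y \<omega>))"
      using that by (intro Bochner_Integration.integrable_add assms(4)) auto
    \<comment> \<open>The left side equals one of the two positive summands, according to the sign
      of \<open>t * Y \<omega>\<close>.\<close>
    have "exp (\<bar>t\<bar> * \<bar>Y \<omega>\<bar>) \<le> exp (t * Y \<omega>) + exp (- t * Y \<omega>)" for \<omega>
      unfolding abs_mult[symmetric] by (cases "t * Y \<omega> \<ge> 0") (simp_all add: add_increasing add_increasing2)
    then show "AE \<omega> in M. norm (exp (\<bar>t\<bar> * \<bar>Y \<omega>\<bar>)) \<le> norm (exp (t * Y \<omega>) + exp (- t * Y \<omega>))"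
      by (simp add: abs_of_pos add_pos_pos)
  qed simp
  have \<mu>_sums: "(\<lambda>k. \<mu> l k * (t ^ k / fact k)) sums \<phi> t ^ l"
    and \<mu>_summable: "summable (\<lambda>k. \<bar>\<mu> l k\<bar> * (\<bar>t\<bar> ^ k / fact k))"
    and \<mu>_le: "(\<Sum>k. \<bar>\<mu> l k\<bar> * (\<bar>t\<bar> ^ k / fact k)) \<le> \<psi> t ^ l" if t: "\<bar>t\<bar> < r" for l t
  proof -
    note E = exp_abs_partial_sum[OF assms(5,6,2) int_abs[OF t], of l]
    have "(\<integral>\<omega>. exp (t * partial_sum X l \<omega>) \<partial>N) = \<phi> t ^ l"
      unfolding \<phi>_def by (rule integral_exp_partial_sum) (use assms t in auto)
    then show "(\<lambda>k. \<mu> l k * (t ^ k / fact k)) sums \<phi> t ^ l"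
      using moment_series_sums_mgf[OF _ E(1)] by (simp add: \<mu>_def)
    show "summable (\<lambda>k. \<bar>\<mu> l k\<bar> * (\<bar>t\<bar> ^ k / fact k))"
      unfolding \<mu>_def by (rule moment_series_abs_bound(1)[OF _ E(1)]) simp
    show "(\<Sum>k. \<bar>\<mu> l k\<bar> * (\<bar>t\<bar> ^ k / fact k)) \<le> \<psi> t ^ l"
      unfolding \<mu>_def \<psi>_def using moment_series_abs_bound(2)[OF _ E(1)] E(2) by simp
  qed

  define c where "c y k = (\<Sum>\<^sub>\<infinity>l. y ^ l / fact l * \<mu> l k)" for y k
  \<comment> \<open>The coefficients do not depend on \<open>t\<close>, so one nonzero point inside
    the radius is enough; \<open>r / 2\<close> is such a point.\<close>
  have c: "((\<lambda>l. y ^ l / fact l * \<mu> l k) has_sum c y k) UNIV" for y k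
    unfolding c_def
    by (rule has_sum_infsum, rule exp_mixture_coeff_summable[OF \<mu>_sums \<mu>_summable \<mu>_le, of "r / 2"])
      (use \<open>r > 0\<close> in simp_all)
  have c_series: "((\<lambda>k. c y k * (t ^ k / fact k)) has_sum exp (y * \<phi> t)) UNIV" if "\<bar>t\<bar> < r" for y t
    by (rule exp_mixture_series[OF \<mu>_sums \<mu>_summable \<mu>_le c]) (use that in auto)

  \<comment> \<open>Coefficients of the product of the expansions at \<open>t / 2\<close> and
    \<open>- t / 2\<close>: the halving gives \<open>1 / 2 ^ k\<close>, the reflection gives the
    signs.\<close>
  define b where "b k = 1 / 2 ^ k *
    (\<Sum>m = 0..k. real (k choose m) * (-1) ^ (k - m) * c x m * c (-x) (k - m))" for k
  have b_sums: "(\<lambda>k. b k * (t ^ k / fact k)) sums central_bell_gf M Y x t" if t: "\<bar>t\<bar> < 2 * r" for t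
  proof -
    define p where "p k = c x k * ((t / 2) ^ k / fact k)" for k
    define q where "q k = c (-x) k * ((- t / 2) ^ k / fact k)" for k
    have p: "(p has_sum exp (x * \<phi> (t / 2))) UNIV"
      unfolding p_def by (rule c_series) (use t in simp)
    have q: "(q has_sum exp (- x * \<phi> (- t / 2))) UNIV"
      unfolding q_def by (rule c_series) (use t in simp)
    \<comment> \<open>Over the reals, unconditional summability is absolute, which is what the
      Cauchy product requires.\<close>
    have abs_summable: "summable (\<lambda>k. norm (h k))" if "(h has_sum s) UNIV" for h :: "nat \<Rightarrow> real" and s
      by (rule summable_on_imp_summable[OF summable_on_iff_abs_summable_on_real[THEN iffD1]])
        (rule has_sum_imp_summable[OF that])
    have "(\<lambda>k. \<Sum>m\<le>k. p m * q (k - m)) sums (suminf p * suminf q)"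
      by (rule Cauchy_product_sums[OF abs_summable[OF p] abs_summable[OF q]])
    also have "suminf p * suminf q = exp (x * \<phi> (t / 2)) * exp (- x * \<phi> (- t / 2))"
      using has_sum_imp_sums[OF p] has_sum_imp_sums[OF q] by (simp only: sums_iff)
    also have "\<dots> = central_bell_gf M Y x t"
      by (simp add: central_bell_gf_def \<phi>_def right_diff_distrib mult.commute flip: exp_add)
    also have "(\<lambda>k. \<Sum>m\<le>k. p m * q (k - m)) = (\<lambda>k. b k * (t ^ k / fact k))"
    proof
      fix k
      have "p m * q (k - m) = 1 / 2 ^ k *
          (real (k choose m) * (-1) ^ (k - m) * c x m * c (-x) (k - m)) * (t ^ k / fact k)"
        if "m \<le> k" for m
      proof -
        have "(t / 2) ^ m * (- t / 2) ^ (k - m) = (-1) ^ (k - m) * (t / 2) ^ k"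
          using that power_add[of "t / 2" m "k - m"]
          by (simp only: minus_divide_left[symmetric] power_minus[of "t / 2"] mult_ac le_add_diff_inverse)
        then have "p m * q (k - m) =
            c x m * c (-x) (k - m) * ((-1) ^ (k - m) * (t / 2) ^ k) / (fact m * fact (k - m))"
          by (simp add: p_def q_def)
        then show ?thesis
          using that by (simp add: binomial_fact power_divide)
      qed
      then show "(\<Sum>m\<le>k. p m * q (k - m)) = b k * (t ^ k / fact k)"
        by (simp add: b_def sum_distrib_left sum_distrib_right sum_divide_distrib atMost_atLeast0)
    qed
    finally show ?thesis .
  qed
  have "\<forall>\<^sub>F t in nhds 0. (\<lambda>k. b k * (t ^ k / fact k)) sums central_bell_gf M Y x t"
    unfolding eventually_nhds_metric
    by (rule exI[of _ "2 * r"]) (use \<open>r > 0\<close> b_sums in \<open>auto simp: dist_real_def\<close>)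
  then have bell: "prob_central_bell M Y n x = b n"
    by (rule prob_central_bell_eqI)

  define a where "a l j = x ^ (l + j) / (fact l * fact j) * (-1) ^ j *
    (\<Sum>m = 0..n. real (n choose m) * (-1) ^ (n - m) * \<mu> l m * \<mu> j (n - m))" for l j
  have c_sums: "(\<lambda>l. y ^ l / fact l * \<mu> l k) sums c y k" for y k
    by (rule has_sum_imp_sums[OF c])
  \<comment> \<open>The sign \<open>(-1) ^ j\<close> merges with \<open>x ^ j\<close> into
    \<open>(-x) ^ j\<close>. As the sum over \<open>m\<close> is finite, the sum over
    \<open>j\<close> can be taken inside it and yields \<open>c (-x) (n - m)\<close>.\<close>
  have inner: "a l sums
      (\<Sum>m = 0..n. x ^ l / fact l * (real (n choose m) * (-1) ^ (n - m) * \<mu> l m) * c (-x) (n - m))" for l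
  proof -
    have "a l = (\<lambda>j. \<Sum>m = 0..n.
        x ^ l / fact l * (real (n choose m) * (-1) ^ (n - m) * \<mu> l m) * ((-x) ^ j / fact j * \<mu> j (n - m)))"
      by (simp add: a_def fun_eq_iff sum_distrib_left power_add power_minus[of x] mult_ac)
    then show ?thesis
      by (simp only:) (intro sums_sum sums_mult c_sums)
  qed
  \<comment> \<open>Likewise the sum over \<open>l\<close> yields \<open>c x m\<close>; the result
    is \<open>b n\<close> without its factor \<open>1 / 2 ^ n\<close>.\<close>
  have "(\<lambda>l. \<Sum>m = 0..n. real (n choose m) * (-1) ^ (n - m) * c (-x) (n - m) * (x ^ l / fact l * \<mu> l m))
      sums (\<Sum>m = 0..n. real (n choose m) * (-1) ^ (n - m) * c (-x) (n - m) * c x m)"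
    by (intro sums_sum sums_mult c_sums)
  then have outer: "(\<lambda>l. \<Sum>j. a l j) sums (2 ^ n * b n)"
    using sums_unique[OF inner] by (simp add: b_def mult_ac)
  have "(\<forall>l. summable (a l)) \<and> summable (\<lambda>l. \<Sum>j. a l j) \<and>
      prob_central_bell M Y n x = 1 / 2 ^ n * (\<Sum>l. \<Sum>j. a l j)"
    using sums_summable[OF inner] outer bell by (simp add: sums_iff)
  then show ?thesis
    unfolding Let_def a_def \<mu>_def .
qed

end
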